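(* Let $g:[1,\infty)\to\mathbb{R}$ and assume there are constants $M,M'\ge0$ such that $x\mapsto g(x)+Mx$ is non-decreasing on $[1,\infty)$ and \[ \left|\int_1^x\frac{g(t)}{t^2}\,dt\right|\le M'\quad\text{for all } x\ge1. \] Then $S:=\limsup_{x\to\infty}\frac{|g(x)|}{x}<\infty$, and if $S>0$ then \[ \limsup_{x\to\infty}\frac{1}{\log x}\int_1^x\frac{|g(t)|}{t^2}\,dt<S. \] *)

theory Defs
  imports "HOL-Analysis.Analysis"
begin

end

theory Submission
  imports Defs
begin

text \<open>
  In the variable \<open>ln t\<close>, the function \<open>h = g t / t\<close> may jump up but decreases at a bounded rate,
  and its integral over any interval is at most \<open>2 M'\<close> in absolute value. The first
  property shows that a very large value of \<open>|h|\<close> persists long enough to violate the second, so \<open>S\<close> is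
  finite.

  If \<open>S > 0\<close>, consider a block \<open>[a, a exp (2 l)]\<close> with \<open>l\<close> large and fixed. If \<open>h\<close> falls from a
  nonnegative value to one below \<open>- S / 2\<close> inside the block, it spends a definite amount of
  logarithmic time with \<open>|h| \<le> S / 2\<close>. Otherwise \<open>h\<close> is negative on the first half of the block or
  at least \<open>- S / 2\<close> on the second half; there the boundedness of the integral of \<open>h\<close> keeps the
  integral of \<open>|h|\<close> well below \<open>S\<close> times the length. So each block loses a fixed
  amount against the trivial bound, which gives a mean strictly below \<open>S\<close>.
\<close>

section \<open>Two elementary integrals\<close>

lemma has_integral_const_over_x:
  fixes a b c :: real
  assumes "0 < a" "a \<le> b"
  shows "((\<lambda>t. c / t) has_integral c * ln (b / a)) {a..b}"
proof -
  have "((\<lambda>t. c / t) has_integral c * ln b - c * ln a) {a..b}"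
    using assms
    by (intro fundamental_theorem_of_calculus)
       (auto intro!: derivative_eq_intros simp flip: has_real_derivative_iff_has_vector_derivative)
  then show ?thesis
    using assms by (simp add: ln_div right_diff_distrib)
qed

lemma has_integral_const_over_square:
  fixes a b c :: real
  assumes "0 < a" "a \<le> b"
  shows "((\<lambda>t. c / t\<^sup>2) has_integral c / a - c / b) {a..b}"
proof -
  have "((\<lambda>t. c / t\<^sup>2) has_integral (- c / b) - (- c / a)) {a..b}"
    using assms
    by (intro fundamental_theorem_of_calculus)
       (auto intro!: derivative_eq_intros simp: power2_eq_square
             simp flip: has_real_derivative_iff_has_vector_derivative)
  then show ?thesis by simp
qed

section \<open>Integrability and bounded integrals\<close>

text \<open>\<open>M\<close> is strictly positive so that \<open>g\<close> needs at least
  \<open>r / M\<close> of distance to fall by \<open>r\<close>; the arguments below divide by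
  \<open>M\<close>.\<close>

locale one_sided_lipschitz =
  fixes g :: "real \<Rightarrow> real" and M M' :: real
  assumes M_pos: "M > 0"
    and shifted_mono: "\<lbrakk>1 \<le> s; s \<le> t\<rbrakk> \<Longrightarrow> g s + M * s \<le> g t + M * t"
    and integral_from_1_bound: "1 \<le> x \<Longrightarrow> \<bar>integral {1..x} (\<lambda>t. g t / t\<^sup>2)\<bar> \<le> M'"
begin

lemma integrable_over_square:
  assumes "1 \<le> a"
  shows "(\<lambda>t. g t / t\<^sup>2) integrable_on {a..b}"
proof (cases "a \<le> b")
  case True
  have inv: "(\<lambda>t. 1 / t\<^sup>2) integrable_on {a..b}"
    using has_integral_const_over_square[of a b 1] assms True by (auto simp: integrable_on_def)
  \<comment> \<open>The point \<open>c\<close> is irrelevant: the second mean value theorem serves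
    to show that a monotone function times an integrable one is integrable.\<close>
  obtain c where "((\<lambda>t. (g t + M * t) * (1 / t\<^sup>2)) has_integral
      (g a + M * a) * integral {a..c} (\<lambda>t. 1 / t\<^sup>2) + (g b + M * b) * integral {c..b} (\<lambda>t. 1 / t\<^sup>2)) {a..b}"
    by (rule second_mean_value_theorem_full[OF inv True, of "\<lambda>t. g t + M * t"])
       (use assms shifted_mono in auto)
  then have "(\<lambda>t. (g t + M * t) * (1 / t\<^sup>2)) integrable_on {a..b}"
    by (auto simp: integrable_on_def)
  moreover have "(\<lambda>t. M / t) integrable_on {a..b}"
    using has_integral_const_over_x[of a b M] assms True by (auto simp: integrable_on_def)
  ultimately have "(\<lambda>t. (g t + M * t) * (1 / t\<^sup>2) - M / t) integrable_on {a..b}"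
    by (rule integrable_diff)
  moreover have "(g t + M * t) * (1 / t\<^sup>2) - M / t = g t / t\<^sup>2" if "t \<in> {a..b}" for t
    using that assms by (simp add: field_simps power2_eq_square)
  ultimately show ?thesis
    by (metis (no_types, lifting) integrable_cong)
qed (simp add: integrable_on_empty)

lemma abs_integrable_over_square:
  assumes "1 \<le> a"
  shows "(\<lambda>t. \<bar>g t\<bar> / t\<^sup>2) integrable_on {a..b}"
proof -
  \<comment> \<open>Monotonicity of \<open>g t + M * t\<close> traps \<open>g t\<close> between its
    values at the two endpoints, up to \<open>M * t\<close>.\<close>
  define B where "B = \<bar>g a + M * a\<bar> + \<bar>g b + M * b\<bar> + M * \<bar>b\<bar>"
  have "\<bar>g t / t\<^sup>2\<bar> \<le> B" if "t \<in> {a..b}" for t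
  proof -
    have t: "a \<le> t" "t \<le> b" "1 \<le> t" using that assms by auto
    have "M * t \<le> M * \<bar>b\<bar>" "0 \<le> M * t" using t M_pos by auto
    then have "\<bar>g t\<bar> \<le> B"
      using shifted_mono[of a t] shifted_mono[of t b] t assms unfolding B_def by linarith
    moreover have "\<bar>g t / t\<^sup>2\<bar> \<le> \<bar>g t\<bar>"
      using t by (simp add: divide_le_eq mult_le_cancel_left1)
    ultimately show ?thesis by linarith
  qed
  then have "(\<lambda>t. g t / t\<^sup>2) absolutely_integrable_on {a..b}"
    by (intro measurable_bounded_by_integrable_imp_absolutely_integrable[where g = "\<lambda>_. B"]
        integrable_imp_measurable integrable_over_square assms) auto
  then show ?thesis
    by (simp add: absolutely_integrable_on_def)
qed

lemma integral_bound:
  assumes "1 \<le> a" "a \<le> b"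
  shows "\<bar>integral {a..b} (\<lambda>t. g t / t\<^sup>2)\<bar> \<le> 2 * M'"
  using Henstock_Kurzweil_Integration.integral_combine
      [OF assms integrable_over_square[of 1 b]] assms
    integral_from_1_bound[of a] integral_from_1_bound[of b] by auto

section \<open>Linear growth of \<open>g\<close>\<close>

text \<open>To the right of \<open>x\<close>, \<open>g\<close> lies above the line of slope
  \<open>- M\<close> through its value at \<open>x\<close>. Integrating this minorant over
  \<open>{x..2 * x}\<close> gives about half of \<open>g x / x\<close>, which must stay below
  \<open>2 * M'\<close>.\<close>

lemma growth_above:
  assumes "1 \<le> x"
  shows "g x \<le> (4 * M' + 2 * M) * x"
proof -
  have "((\<lambda>t. (g x + M * x) / t\<^sup>2 - M / t) has_integral
      ((g x + M * x) / x - (g x + M * x) / (2 * x)) - M * ln (2 * x / x)) {x..2 * x}"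
    using assms
    by (intro has_integral_diff has_integral_const_over_square has_integral_const_over_x) auto
  moreover have "((\<lambda>t. g t / t\<^sup>2) has_integral integral {x..2 * x} (\<lambda>t. g t / t\<^sup>2)) {x..2 * x}"
    using integrable_over_square assms by (simp add: integrable_integral)
  moreover have "(g x + M * x) / t\<^sup>2 - M / t \<le> g t / t\<^sup>2" if "t \<in> {x..2 * x}" for t
  proof -
    have "(g x + M * x) / t\<^sup>2 - M / t = (g x + M * x - M * t) / t\<^sup>2"
      using that assms by (simp add: field_simps power2_eq_square)
    also have "\<dots> \<le> g t / t\<^sup>2"
      using shifted_mono[of x t] that assms by (intro divide_right_mono) auto
    finally show ?thesis .
  qed
  ultimately have "((g x + M * x) / x - (g x + M * x) / (2 * x)) - M * ln (2 * x / x)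
      \<le> integral {x..2 * x} (\<lambda>t. g t / t\<^sup>2)"
    by (rule has_integral_le)
  also have "\<dots> \<le> 2 * M'"
    using integral_bound[of x "2 * x"] assms by auto
  finally have "g x / x + M - (g x / x + M) / 2 - M * ln 2 \<le> 2 * M'"
    using assms by (simp add: add_divide_distrib)
  moreover have "M * ln 2 \<le> M * 1"
    using M_pos ln_2_less_1 by (intro mult_left_mono) auto
  ultimately have "g x / x \<le> 4 * M' + 2 * M"
    using M_pos by argo
  then show ?thesis
    using assms by (simp add: divide_le_eq)
qed

text \<open>The mirror image: to the left of \<open>x\<close>, \<open>g\<close> lies below that
  line, so a very negative value at \<open>x\<close> forces a very negative integral over
  \<open>{x / 2..x}\<close>. The bound \<open>2 \<le> x\<close> keeps this interval inside the
  domain.\<close>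

lemma growth_below:
  assumes "2 \<le> x"
  shows "- ((2 * M' + M) * x) \<le> g x"
proof -
  have "((\<lambda>t. (g x + M * x) / t\<^sup>2 - M / t) has_integral
      ((g x + M * x) / (x / 2) - (g x + M * x) / x) - M * ln (x / (x / 2))) {x / 2..x}"
    using assms
    by (intro has_integral_diff has_integral_const_over_square has_integral_const_over_x) auto
  moreover have "((\<lambda>t. g t / t\<^sup>2) has_integral integral {x / 2..x} (\<lambda>t. g t / t\<^sup>2)) {x / 2..x}"
    using integrable_over_square assms by (simp add: integrable_integral)
  moreover have "g t / t\<^sup>2 \<le> (g x + M * x) / t\<^sup>2 - M / t" if "t \<in> {x / 2..x}" for t
  proof -
    have "g t / t\<^sup>2 \<le> (g x + M * x - M * t) / t\<^sup>2"
      using shifted_mono[of t x] that assms by (intro divide_right_mono) auto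
    also have "\<dots> = (g x + M * x) / t\<^sup>2 - M / t"
      using that assms by (simp add: field_simps power2_eq_square)
    finally show ?thesis .
  qed
  ultimately have "integral {x / 2..x} (\<lambda>t. g t / t\<^sup>2)
      \<le> ((g x + M * x) / (x / 2) - (g x + M * x) / x) - M * ln (x / (x / 2))"
    using has_integral_le by blast
  then have "integral {x / 2..x} (\<lambda>t. g t / t\<^sup>2) \<le> 2 * (g x / x + M) - (g x / x + M) - M * ln 2"
    using assms by (simp add: add_divide_distrib)
  moreover have "- (2 * M') \<le> integral {x / 2..x} (\<lambda>t. g t / t\<^sup>2)"
    using integral_bound[of "x / 2" x] assms by auto
  moreover have "0 \<le> M * ln 2"
    using M_pos by auto
  ultimately have "- (2 * M' + M) \<le> g x / x"
    by argo
  then show ?thesis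
    using assms by (simp add: le_divide_eq left_diff_distrib distrib_right)
qed

lemma M'_nonneg: "0 \<le> M'"
  using integral_from_1_bound[of 1] by simp

lemma linear_growth:
  assumes "2 \<le> x"
  shows "\<bar>g x\<bar> / x \<le> 4 * M' + 2 * M"
proof -
  have "(2 * M' + M) * x \<le> (4 * M' + 2 * M) * x"
    using assms M_pos M'_nonneg by (intro mult_right_mono) auto
  then have "\<bar>g x\<bar> \<le> (4 * M' + 2 * M) * x"
    using growth_above[of x] growth_below[of x] assms by linarith
  then show ?thesis
    using assms by (simp add: divide_le_eq)
qed

section \<open>Estimates on one block\<close>

text \<open>Substitute for the intermediate value theorem: \<open>g\<close> may jump, but only
  upwards, so on the way down it cannot skip zero. The last point where \<open>g\<close> is
  nonnegative works.\<close>

lemma descending_zero: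
  assumes "1 \<le> x0" "x0 \<le> x1" "0 \<le> g x0" "g x1 \<le> 0"
  obtains y where "x0 \<le> y" "y \<le> x1" "g y = 0" "\<And>t. y < t \<Longrightarrow> t \<le> x1 \<Longrightarrow> g t < 0"
proof -
  define A where "A = {t \<in> {x0..x1}. 0 \<le> g t}"
  define y where "y = Sup A"
  have A: "x0 \<in> A" "bdd_above A"
    using assms by (auto simp: A_def)
  have x0y: "x0 \<le> y"
    unfolding y_def using A by (rule cSup_upper)
  have yx1: "y \<le> x1"
    unfolding y_def by (rule cSup_least) (use A(1) in \<open>auto simp: A_def\<close>)
  have neg: "g t < 0" if "y < t" "t \<le> x1" for t
  proof (rule ccontr)
    assume "\<not> g t < 0"
    then have "t \<in> A" using that x0y by (auto simp: A_def)
    then show False using cSup_upper[of t A] A that by (auto simp: y_def)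
  qed
  have "0 \<le> g y"
  proof (rule ccontr)
    assume c: "\<not> 0 \<le> g y"
    \<comment> \<open>A point of \<open>A\<close> this close to \<open>y\<close> would need a fall
      steeper than \<open>M\<close> to reach the negative value \<open>g y\<close>.\<close>
    then have "y + g y / M < Sup A"
      using M_pos by (simp add: y_def divide_neg_pos)
    then obtain t where t: "t \<in> A" "y + g y / M < t"
      using less_cSup_iff[of A] A by auto
    then have "t \<le> y" using cSup_upper[of t A] A by (simp add: y_def)
    then have "g t + M * t \<le> g y + M * y"
      using shifted_mono[of t y] t assms by (auto simp: A_def)
    moreover have "M * y + g y < M * t"
      using t(2) M_pos by (simp add: field_simps)
    ultimately show False using t(1) by (auto simp: A_def)
  qed
  moreover have "g y \<le> 0"
  proof (rule ccontr)
    assume c: "\<not> g y \<le> 0"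
    then have "y < x1" using assms yx1 by (cases "y = x1") auto
    \<comment> \<open>Starting from \<open>g y > 0\<close>, \<open>g\<close> is still nonnegative at
      this later point, against the choice of \<open>y\<close>.\<close>
    define t where "t = min x1 (y + g y / M)"
    have t: "y < t" "t \<le> x1" "t \<le> y + g y / M"
      using c M_pos \<open>y < x1\<close> by (auto simp: t_def)
    then have "M * t \<le> M * y + g y"
      using M_pos by (simp add: field_simps)
    then show False
      using shifted_mono[of y t] neg[of t] t x0y assms by auto
  qed
  ultimately show thesis
    using that x0y yx1 neg by force
qed

lemma abs_integral_le:
  assumes "1 \<le> a" "a \<le> b" "\<And>t. a \<le> t \<Longrightarrow> t \<le> b \<Longrightarrow> \<bar>g t\<bar> \<le> c * t"
  shows "integral {a..b} (\<lambda>t. \<bar>g t\<bar> / t\<^sup>2) \<le> c * ln (b / a)"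
proof (rule has_integral_le)
  show "((\<lambda>t. \<bar>g t\<bar> / t\<^sup>2) has_integral integral {a..b} (\<lambda>t. \<bar>g t\<bar> / t\<^sup>2)) {a..b}"
    using abs_integrable_over_square assms by (simp add: integrable_integral)
  show "((\<lambda>t. c / t) has_integral c * ln (b / a)) {a..b}"
    using assms by (intro has_integral_const_over_x) auto
  show "\<bar>g t\<bar> / t\<^sup>2 \<le> c / t" if "t \<in> {a..b}" for t
  proof -
    have "\<bar>g t\<bar> / t\<^sup>2 \<le> c * t / t\<^sup>2"
      using assms(3)[of t] that by (intro divide_right_mono) auto
    then show ?thesis
      using that assms(1) by (simp add: power2_eq_square)
  qed
qed

text \<open>The bound comes from the chord of the convex function \<open>|h|\<close> over \<open>[- c / 2, c]\<close>, that is,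
  \<open>|h| \<le> 2 / 3 * c + h / 3\<close>.\<close>

lemma abs_integral_le_of_one_sided:
  assumes "1 \<le> a" "a \<le> b" "\<And>t. a \<le> t \<Longrightarrow> t \<le> b \<Longrightarrow> \<bar>g t\<bar> \<le> c * t"
    and "\<And>t. a \<le> t \<Longrightarrow> t \<le> b \<Longrightarrow> - (c / 2) * t \<le> g t"
  shows "integral {a..b} (\<lambda>t. \<bar>g t\<bar> / t\<^sup>2) \<le> 2 / 3 * c * ln (b / a) + 2 / 3 * M'"
proof -
  have "integral {a..b} (\<lambda>t. \<bar>g t\<bar> / t\<^sup>2)
      \<le> 2 / 3 * c * ln (b / a) + 1 / 3 * integral {a..b} (\<lambda>t. g t / t\<^sup>2)"
  proof (rule has_integral_le)
    show "((\<lambda>t. \<bar>g t\<bar> / t\<^sup>2) has_integral integral {a..b} (\<lambda>t. \<bar>g t\<bar> / t\<^sup>2)) {a..b}"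
      using abs_integrable_over_square assms by (simp add: integrable_integral)
    show "((\<lambda>t. 2 / 3 * c / t + 1 / 3 * (g t / t\<^sup>2)) has_integral
        2 / 3 * c * ln (b / a) + 1 / 3 * integral {a..b} (\<lambda>t. g t / t\<^sup>2)) {a..b}"
      using assms integrable_over_square
      by (intro has_integral_add has_integral_const_over_x has_integral_mult_right integrable_integral) auto
    show "\<bar>g t\<bar> / t\<^sup>2 \<le> 2 / 3 * c / t + 1 / 3 * (g t / t\<^sup>2)" if "t \<in> {a..b}" for t
    proof -
      have "\<bar>g t\<bar> \<le> 2 / 3 * (c * t) + 1 / 3 * g t"
        using assms(3,4)[of t] that by auto
      then have "\<bar>g t\<bar> / t\<^sup>2 \<le> (2 / 3 * (c * t) + 1 / 3 * g t) / t\<^sup>2"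
        by (intro divide_right_mono) auto
      also have "\<dots> = 2 / 3 * c / t + 1 / 3 * (g t / t\<^sup>2)"
        using that assms(1) by (simp add: field_simps power2_eq_square)
      finally show ?thesis .
    qed
  qed
  then show ?thesis
    using integral_bound[OF assms(1,2)] by linarith
qed

lemma abs_integral_combine:
  assumes "1 \<le> a" "a \<le> c" "c \<le> b"
  shows "integral {a..b} (\<lambda>t. \<bar>g t\<bar> / t\<^sup>2)
    = integral {a..c} (\<lambda>t. \<bar>g t\<bar> / t\<^sup>2) + integral {c..b} (\<lambda>t. \<bar>g t\<bar> / t\<^sup>2)"
  using Henstock_Kurzweil_Integration.integral_combine
      [OF assms(2,3) abs_integrable_over_square[OF assms(1)]] by simp

text \<open>After its last zero \<open>y\<close>, \<open>g\<close> still has to descend to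
  \<open>- (s / 2) * x1\<close> at slope at least \<open>- M\<close>. On the stretch this takes,
  \<open>s / 2\<close> replaces \<open>c\<close> in the trivial bound.\<close>

lemma block_with_sign_change:
  assumes s: "0 < s" "s \<le> c" and ab: "1 \<le> a" "a \<le> x0" "x0 \<le> x1" "x1 \<le> b"
    and le: "\<And>t. a \<le> t \<Longrightarrow> t \<le> b \<Longrightarrow> \<bar>g t\<bar> \<le> c * t"
    and x0: "0 \<le> g x0" and x1: "g x1 \<le> - (s / 2) * x1"
  shows "integral {a..b} (\<lambda>t. \<bar>g t\<bar> / t\<^sup>2) \<le> c * ln (b / a) - s / 2 * ln (1 + s / (2 * M))"
proof -
  have "- (s / 2) * x1 \<le> 0" using s ab by auto
  then obtain y where y: "x0 \<le> y" "y \<le> x1" "g y = 0"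
      and neg: "\<And>t. y < t \<Longrightarrow> t \<le> x1 \<Longrightarrow> g t < 0"
    using descending_zero[of x0 x1] ab x0 x1 by (metis order_trans)
  \<comment> \<open>Here the line of slope \<open>- M\<close> starting from zero at \<open>y\<close>
    reaches \<open>- (s / 2) * y\<close>.\<close>
  define w where "w = y * (1 + s / (2 * M))"
  have y1: "1 \<le> y" using y ab by linarith
  have "s / 2 * y \<le> s / 2 * x1" using s y by (intro mult_left_mono) auto
  then have "s / 2 * y \<le> M * (x1 - y)"
    using shifted_mono[of y x1] y y1 x1 by (simp add: algebra_simps)
  then have wx1: "w \<le> x1"
    using M_pos by (simp add: w_def field_simps)
  have yw: "y \<le> w"
    using y1 s M_pos by (simp add: w_def)
  have small: "\<bar>g t\<bar> \<le> s / 2 * t" if t: "y \<le> t" "t \<le> w" for t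
  proof -
    have "g t \<le> 0" using neg[of t] t wx1 y by (cases "t = y") auto
    moreover have "- g t \<le> M * t - M * y"
      using shifted_mono[of y t] y t y1 by auto
    moreover have "M * t \<le> M * w" using t M_pos by auto
    moreover have "M * w = M * y + s / 2 * y" using M_pos by (simp add: w_def field_simps)
    moreover have "s / 2 * y \<le> s / 2 * t" using s t by auto
    ultimately show ?thesis by linarith
  qed
  have "integral {a..b} (\<lambda>t. \<bar>g t\<bar> / t\<^sup>2) = integral {a..y} (\<lambda>t. \<bar>g t\<bar> / t\<^sup>2)
      + integral {y..w} (\<lambda>t. \<bar>g t\<bar> / t\<^sup>2) + integral {w..b} (\<lambda>t. \<bar>g t\<bar> / t\<^sup>2)"
    using abs_integral_combine[of a y b] abs_integral_combine[of y w b] ab y y1 yw wx1 by auto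
  also have "\<dots> \<le> c * ln (y / a) + s / 2 * ln (w / y) + c * ln (b / w)"
    using ab y y1 yw wx1 small by (intro add_mono abs_integral_le le) auto
  also have "\<dots> = c * ln (b / a) - (c - s / 2) * ln (w / y)"
    using ab y y1 yw wx1 by (simp add: ln_div algebra_simps)
  also have "ln (w / y) = ln (1 + s / (2 * M))"
    using y1 by (simp add: w_def)
  also have "c * ln (b / a) - (c - s / 2) * ln (1 + s / (2 * M))
      \<le> c * ln (b / a) - s / 2 * ln (1 + s / (2 * M))"
    using s M_pos by (intro diff_left_mono mult_right_mono) auto
  finally show ?thesis .
qed

text \<open>Later \<open>s\<close> is the limsup and \<open>c\<close> slightly exceeds it; the
  saving does not depend on \<open>c\<close>, so \<open>c - s\<close> can be chosen in terms of it.
  The value of \<open>s * l\<close> makes both \<open>s * l / 3 - 2 / 3 * M'\<close> and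
  \<open>s * l - 2 * M'\<close> at least 1, the savings wanted in the last two cases.\<close>

lemma block_bound:
  assumes s: "0 < s" "s \<le> c" and a: "1 \<le> a" and l: "s * l = 12 * M' + 6"
    and le: "\<And>t. a \<le> t \<Longrightarrow> \<bar>g t\<bar> \<le> c * t"
  shows "integral {a..a * exp (2 * l)} (\<lambda>t. \<bar>g t\<bar> / t\<^sup>2)
    \<le> c * (2 * l) - min 1 (s / 2 * ln (1 + s / (2 * M)))"
proof -
  define m b where "m = a * exp l" and "b = a * exp (2 * l)"
  have "0 < s * l" using l M'_nonneg by linarith
  then have "0 < l" using s by (simp add: zero_less_mult_iff)
  have sl: "s * l \<le> c * l" using s \<open>0 < l\<close> by (intro mult_right_mono) auto
  have am: "a \<le> m" and mb: "m \<le> b"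
    using a \<open>0 < l\<close> by (auto simp: m_def b_def)
  have ln: "ln (m / a) = l" "ln (b / m) = l" "ln (b / a) = 2 * l"
    using a by (auto simp: m_def b_def simp flip: exp_diff)
  \<comment> \<open>Either \<open>g\<close> is negative on the whole first half, or it is
    nonnegative at some \<open>x0\<close> there and then does or does not drop to
    \<open>- s / 2\<close> relative size. In the last case \<open>{x0..b}\<close> contains the
    second half.\<close>
  consider (change) x0 x1 where "a \<le> x0" "x0 \<le> x1" "x1 \<le> b" "0 \<le> g x0" "g x1 \<le> - (s / 2) * x1"
    | (nonneg) x0 where "a \<le> x0" "x0 \<le> m" "0 \<le> g x0"
        "\<And>t. x0 \<le> t \<Longrightarrow> t \<le> b \<Longrightarrow> - (s / 2) * t \<le> g t"
    | (neg) "\<And>t. a \<le> t \<Longrightarrow> t \<le> m \<Longrightarrow> g t < 0"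
  proof (cases "\<exists>x0. a \<le> x0 \<and> x0 \<le> m \<and> 0 \<le> g x0")
    case True
    then obtain x0 where x0: "a \<le> x0" "x0 \<le> m" "0 \<le> g x0" by blast
    show thesis
    proof (cases "\<exists>x1. x0 \<le> x1 \<and> x1 \<le> b \<and> g x1 \<le> - (s / 2) * x1")
      case True
      then show thesis using x0 change by blast
    next
      case False
      then show thesis using x0 by (intro nonneg[of x0]) force+
    qed
  next
    case False
    then show thesis by (intro neg) force
  qed
  then have "integral {a..b} (\<lambda>t. \<bar>g t\<bar> / t\<^sup>2)
    \<le> c * (2 * l) - min 1 (s / 2 * ln (1 + s / (2 * M)))"
  proof cases
    case change
    then show ?thesis
      using block_with_sign_change[of s c a x0 x1 b] s a le ln by auto
  next
    case nonneg
    have x0b: "x0 \<le> b" using nonneg mb by linarith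
    have "- (c / 2) * t \<le> g t" if "x0 \<le> t" "t \<le> b" for t
    proof -
      have "s / 2 * t \<le> c / 2 * t" using s that nonneg a by (intro mult_right_mono) auto
      then show ?thesis using nonneg(4)[OF that] by linarith
    qed
    then have "integral {x0..b} (\<lambda>t. \<bar>g t\<bar> / t\<^sup>2) \<le> 2 / 3 * c * ln (b / x0) + 2 / 3 * M'"
      using nonneg a x0b le by (intro abs_integral_le_of_one_sided) auto
    moreover have "integral {a..x0} (\<lambda>t. \<bar>g t\<bar> / t\<^sup>2) \<le> c * ln (x0 / a)"
      using nonneg a le by (intro abs_integral_le) auto
    moreover have "c * ln (x0 / a) = c * (2 * l) - c * ln (b / x0)"
    proof -
      have "ln (x0 / a) = ln (b / a) - ln (b / x0)"
        using nonneg a x0b by (simp add: ln_div)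
      then show ?thesis using ln by (simp add: right_diff_distrib)
    qed
    moreover have "c * l \<le> c * ln (b / x0)"
    proof -
      have "b / m \<le> b / x0"
        using nonneg a x0b by (intro divide_left_mono) auto
      then have "ln (b / m) \<le> ln (b / x0)"
        using nonneg a x0b am mb by (subst ln_le_cancel_iff) auto
      then show ?thesis
        using ln s by (intro mult_left_mono) auto
    qed
    ultimately show ?thesis
      using abs_integral_combine[of a x0 b] nonneg a x0b sl l M'_nonneg by linarith
  next
    \<comment> \<open>On the first half \<open>g\<close> has constant sign, so the integral of its
      absolute value is at most \<open>2 * M'\<close> instead of \<open>c * l\<close>.\<close>
    case neg
    have "integral {a..m} (\<lambda>t. \<bar>g t\<bar> / t\<^sup>2) = integral {a..m} (\<lambda>t. - (g t / t\<^sup>2))"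
      by (intro integral_cong) (use neg in \<open>auto simp: abs_of_neg\<close>)
    also have "\<dots> \<le> 2 * M'"
      using integral_bound[OF a am] by auto
    finally have "integral {a..m} (\<lambda>t. \<bar>g t\<bar> / t\<^sup>2) \<le> 2 * M'" .
    moreover have "integral {m..b} (\<lambda>t. \<bar>g t\<bar> / t\<^sup>2) \<le> c * l"
      using abs_integral_le[of m b c] a am mb le ln by auto
    ultimately show ?thesis
      using abs_integral_combine[of a m b] a am mb sl l M'_nonneg by linarith
  qed
  then show ?thesis by (simp add: b_def)
qed

section \<open>Summing over blocks and passing to the limit\<close>

lemma iterate_blocks:
  assumes a: "1 \<le> a" and "0 < L"
    and block: "\<And>x. a \<le> x \<Longrightarrow> integral {x..x * exp L} (\<lambda>t. \<bar>g t\<bar> / t\<^sup>2) \<le> q * L"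
    and "a \<le> x"
  shows "integral {1..x} (\<lambda>t. \<bar>g t\<bar> / t\<^sup>2)
    \<le> integral {1..a * exp L} (\<lambda>t. \<bar>g t\<bar> / t\<^sup>2) + \<bar>q\<bar> * L + q * ln (x / a)"
proof -
  let ?H = "\<lambda>x. integral {1..x} (\<lambda>t. \<bar>g t\<bar> / t\<^sup>2)"
  \<comment> \<open>The induction is on a bound \<open>n\<close> for the number of blocks needed to
    cover \<open>{a..x}\<close>.\<close>
  obtain n where "x / a < exp L ^ n"
    using real_arch_pow[of "exp L" "x / a"] \<open>0 < L\<close> by auto
  then have "x \<le> a * exp L ^ n" using a by (simp add: field_simps)
  with \<open>a \<le> x\<close> show ?thesis
  proof (induction n arbitrary: x)
    case 0
    have "0 \<le> integral {x..a * exp L} (\<lambda>t. \<bar>g t\<bar> / t\<^sup>2)"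
      by (intro integral_nonneg abs_integrable_over_square) (use 0 a in auto)
    moreover have "a \<le> a * exp L" using a \<open>0 < L\<close> by auto
    moreover have "x = a" using 0 by simp
    moreover have "0 \<le> \<bar>q\<bar> * L" using \<open>0 < L\<close> by simp
    ultimately show ?case
      using abs_integral_combine[of 1 x "a * exp L"] a by auto
  next
    case (Suc n)
    have x: "1 \<le> x" using Suc a by linarith
    show ?case
    proof (cases "x \<le> a * exp L")
      case True
      have "0 \<le> integral {x..a * exp L} (\<lambda>t. \<bar>g t\<bar> / t\<^sup>2)"
        by (intro integral_nonneg abs_integrable_over_square) (use x in auto)
      then have "?H x \<le> ?H (a * exp L)"
        using abs_integral_combine[of 1 x "a * exp L"] x True by auto
      \<comment> \<open>The sign of \<open>q\<close> is arbitrary, so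
        \<open>\<bar>q\<bar> * L\<close> compensates a possibly negative
        \<open>q * ln (x / a)\<close>.\<close>
      moreover have "\<bar>q * ln (x / a)\<bar> \<le> \<bar>q\<bar> * L"
      proof -
        have "ln (x / a) \<le> ln (exp L)"
          using True a x by (subst ln_le_cancel_iff) (auto simp: field_simps)
        moreover have "0 \<le> ln (x / a)" using Suc.prems a by auto
        ultimately show ?thesis by (auto simp: abs_mult intro!: mult_left_mono)
      qed
      ultimately show ?thesis by linarith
    next
      case False
      \<comment> \<open>Peel off the last full block, \<open>{z..x}\<close>.\<close>
      define z where "z = x / exp L"
      have xz: "x = z * exp L" by (simp add: z_def)
      have az: "a \<le> z" using False by (simp add: z_def field_simps)
      have "z \<le> a * exp L ^ n" using Suc.prems by (simp add: z_def field_simps)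
      then have "?H z \<le> ?H (a * exp L) + \<bar>q\<bar> * L + q * ln (z / a)"
        using Suc.IH az by blast
      moreover have "?H x = ?H z + integral {z..x} (\<lambda>t. \<bar>g t\<bar> / t\<^sup>2)"
        using az a \<open>0 < L\<close> by (intro abs_integral_combine) (auto simp: xz)
      moreover have "integral {z..x} (\<lambda>t. \<bar>g t\<bar> / t\<^sup>2) \<le> q * L"
        using block[OF az] by (simp add: xz)
      moreover have "ln (x / a) = ln (z / a) + L"
        using a az by (simp add: xz ln_div ln_mult)
      ultimately show ?thesis by (simp add: distrib_left)
    qed
  qed
qed

lemma Limsup_mean_less:
  assumes s: "Limsup at_top (\<lambda>x. ereal (\<bar>g x\<bar> / x)) = ereal s" "0 < s"
  shows "Limsup at_top (\<lambda>x. ereal (1 / ln x * integral {1..x} (\<lambda>t. \<bar>g t\<bar> / t\<^sup>2))) < ereal s"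
proof -
  define l d where "l = (12 * M' + 6) / s" and "d = min 1 (s / 2 * ln (1 + s / (2 * M)))"
  have l: "0 < l" "s * l = 12 * M' + 6"
    using s M'_nonneg by (auto simp: l_def)
  have "0 < ln (1 + s / (2 * M))" using s M_pos by (intro ln_gt_zero) auto
  then have d: "0 < d" using s by (simp add: d_def)
  \<comment> \<open>Chosen so that the block bound with \<open>c = s + e\<close> becomes exactly
    \<open>s - e\<close> times the length:
    \<open>(s + e) * (2 * l) - d = (s - e) * (2 * l)\<close>.\<close>
  define e where "e = d / (4 * l)"
  have e: "0 < e" "e * l = d / 4" using d l by (auto simp: e_def)
  define q where "q = s - e"
  have "\<forall>\<^sub>F x in at_top. ereal (\<bar>g x\<bar> / x) < ereal (s + e)"
    by (rule Limsup_lessD) (use s e in simp)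
  then obtain a0 where a0: "\<And>x. a0 \<le> x \<Longrightarrow> \<bar>g x\<bar> / x < s + e"
    by (auto simp: eventually_at_top_linorder)
  define a where "a = max 1 a0"
  have a: "1 \<le> a" by (simp add: a_def)
  have le: "\<bar>g x\<bar> \<le> (s + e) * x" if "a \<le> x" for x
    using a0[of x] that by (simp add: a_def divide_less_eq)
  have block: "integral {x..x * exp (2 * l)} (\<lambda>t. \<bar>g t\<bar> / t\<^sup>2) \<le> q * (2 * l)" if "a \<le> x" for x
  proof -
    have "integral {x..x * exp (2 * l)} (\<lambda>t. \<bar>g t\<bar> / t\<^sup>2) \<le> (s + e) * (2 * l) - d"
      unfolding d_def using s e l a that le by (intro block_bound) auto
    also have "\<dots> = q * (2 * l)"
      using e(2) by (simp add: q_def algebra_simps)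
    finally show ?thesis .
  qed
  \<comment> \<open>\<open>D\<close> collects all terms independent of \<open>x\<close>. After
    division by \<open>ln x\<close> it is eventually below \<open>e / 2\<close>, which leaves a
    margin of \<open>e / 2\<close> under \<open>s\<close>.\<close>
  define D where "D = integral {1..a * exp (2 * l)} (\<lambda>t. \<bar>g t\<bar> / t\<^sup>2) + \<bar>q\<bar> * (2 * l) - q * ln a"
  have "((\<lambda>x. D / ln x) \<longlongrightarrow> 0) at_top"
    by (intro real_tendsto_divide_at_top[OF tendsto_const] ln_at_top)
  then have "\<forall>\<^sub>F x in at_top. D / ln x < e / 2"
    using e by (intro order_tendstoD) auto
  moreover have "\<forall>\<^sub>F x in at_top. a \<le> x \<and> 1 < x"
    by (intro eventually_conj eventually_ge_at_top eventually_gt_at_top)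
  ultimately have "\<forall>\<^sub>F x in at_top.
      ereal (1 / ln x * integral {1..x} (\<lambda>t. \<bar>g t\<bar> / t\<^sup>2)) \<le> ereal (s - e / 2)"
  proof eventually_elim
    case (elim x)
    have "integral {1..x} (\<lambda>t. \<bar>g t\<bar> / t\<^sup>2) \<le> D + q * ln x"
      using iterate_blocks[OF a _ block, of x] elim l a by (simp add: D_def ln_div algebra_simps)
    then have "1 / ln x * integral {1..x} (\<lambda>t. \<bar>g t\<bar> / t\<^sup>2) \<le> 1 / ln x * (D + q * ln x)"
      using elim by (intro mult_left_mono) auto
    also have "\<dots> = D / ln x + q"
      using elim by (simp add: field_simps)
    also have "\<dots> \<le> s - e / 2"
      using elim(1) unfolding q_def by argo
    finally show ?case by simp
  qed
  then have "Limsup at_top (\<lambda>x. ereal (1 / ln x * integral {1..x} (\<lambda>t. \<bar>g t\<bar> / t\<^sup>2))) \<le> ereal (s - e / 2)"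
    by (rule Limsup_bounded)
  also have "\<dots> < ereal s" using e by simp
  finally show ?thesis .
qed

end

theorem theorem2p4:
  fixes g :: "real \<Rightarrow> real" and M M' :: real
  assumes "M \<ge> 0" and "M' \<ge> 0"
    and "mono_on {1..} (\<lambda>x. g x + M * x)"
    and "\<forall>x\<ge>1. \<bar>integral {1..x} (\<lambda>t. g t / t\<^sup>2)\<bar> \<le> M'"
  shows "let S = Limsup at_top (\<lambda>x. ereal (\<bar>g x\<bar> / x)) in
           S < \<infinity> \<and>
           (S > 0 \<longrightarrow>
             Limsup at_top (\<lambda>x. ereal (1 / ln x * integral {1..x} (\<lambda>t. \<bar>g t\<bar> / t\<^sup>2))) < S)"
proof -
  \<comment> \<open>\<open>M\<close> itself may be zero; passing to \<open>M + 1\<close> preserves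
    monotonicity and gives the strict positivity.\<close>
  interpret one_sided_lipschitz g "M + 1" M'
  proof
    show "g s + (M + 1) * s \<le> g t + (M + 1) * t" if "1 \<le> s" "s \<le> t" for s t
      using mono_onD[OF assms(3), of s t] that by (simp add: algebra_simps)
  qed (use assms in auto)
  define S where "S = Limsup at_top (\<lambda>x. ereal (\<bar>g x\<bar> / x))"
  have "\<forall>\<^sub>F x in at_top. ereal (\<bar>g x\<bar> / x) \<le> ereal (4 * M' + 2 * (M + 1))"
    using eventually_ge_at_top[of 2] by eventually_elim (use linear_growth in auto)
  then have "S \<le> ereal (4 * M' + 2 * (M + 1))"
    unfolding S_def by (rule Limsup_bounded)
  then have fin: "S < \<infinity>" by auto
  have "Limsup at_top (\<lambda>x. ereal (1 / ln x * integral {1..x} (\<lambda>t. \<bar>g t\<bar> / t\<^sup>2))) < S" if "0 < S"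
  proof -
    obtain s where s: "S = ereal s" using fin \<open>0 < S\<close> by (cases S) auto
    then show ?thesis using Limsup_mean_less[of s] that by (auto simp: S_def)
  qed
  with fin show ?thesis by (simp add: S_def Let_def)
qed

end
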